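(* Let $R$ be a local ring, and let $\sigma: R\to R$ be a ring endomorphism. If $T_3(R,\sigma)$ is strongly clean, then for every $a\in 1+J(R)$ and $b\in J(R)$ the maps $l_{a}-r_{\sigma(b)}$, $l_{a}-r_{\sigma^2(b)}$ and $l_{b}-r_{\sigma(a)}$ from $R$ to $R$ are surjective.
   Context: All rings are associative with identity $1$, not necessarily commutative. $J(R)$ denotes the Jacobson radical of $R$. A ring is local if it has exactly one maximal right ideal. A ring endomorphism $\sigma$ of $R$ satisfies $\sigma(1)=1$, and $\sigma^2=\sigma\circ\sigma$. For a ring $R$ and an endomorphism $\sigma$ of $R$, $T_n(R,\sigma)$ is the ring of all $n\times n$ upper triangular matrices over $R$ with entrywise addition and multiplication $(a_{ij})(b_{ij})=(c_{ij})$, where $c_{ij}=\sum_{k=i}^{n}a_{ik}\sigma^{k-i}(b_{kj})$ for $i\le j$. For $a\in R$, $l_a,r_a: R\to R$ are the additive group endomorphisms $l_a(r)=ar$, $r_a(r)=ra$; thus $(l_a-r_b)(r)=ar-rb$. An element $a$ of a ring $S$ is strongly clean if there exist an idempotent $e\in S$ and a unit $u\in S$ with $a=e+u$ and $eu=ue$. A ring is strongly clean if all its elements are strongly clean. *)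

theory Defs
  imports
    "Jordan_Normal_Form.Matrix"
    "HOL-Algebra.Ideal"
begin

definition right_ideal :: "'a set \<Rightarrow> ('a, 'm) ring_scheme \<Rightarrow> bool" where
  "right_ideal I R \<longleftrightarrow>
     additive_subgroup I R \<and> (\<forall>a\<in>I. \<forall>r\<in>carrier R. a \<otimes>\<^bsub>R\<^esub> r \<in> I)"

definition maximal_right_ideal :: "'a set \<Rightarrow> ('a, 'm) ring_scheme \<Rightarrow> bool" where
  "maximal_right_ideal M R \<longleftrightarrow>
     right_ideal M R \<and> M \<noteq> carrier R \<and>
     (\<forall>I. right_ideal I R \<longrightarrow> M \<subseteq> I \<longrightarrow> I = M \<or> I = carrier R)"

definition jacobson_radical :: "('a, 'm) ring_scheme \<Rightarrow> 'a set" where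
  "jacobson_radical R = {x \<in> carrier R. \<forall>M. maximal_right_ideal M R \<longrightarrow> x \<in> M}"

definition local_ring :: "('a, 'm) ring_scheme \<Rightarrow> bool" where
  "local_ring R \<longleftrightarrow> ring R \<and> (\<exists>!M. maximal_right_ideal M R)"

(* Indices run over 0, ..., n - 1 instead of 1, ..., n; this leaves the exponent k - i in
   the multiplication unchanged. *)
definition skew_triangular_ring ::
  "nat \<Rightarrow> ('a, 'm) ring_scheme \<Rightarrow> ('a \<Rightarrow> 'a) \<Rightarrow> 'a mat ring" where
  "skew_triangular_ring n R \<sigma> =
     \<lparr>carrier = {A \<in> carrier_mat n n.
                  (\<forall>i<n. \<forall>j<n. A $$ (i, j) \<in> carrier R) \<and>
                  (\<forall>i<n. \<forall>j<i. A $$ (i, j) = \<zero>\<^bsub>R\<^esub>)},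
      mult = (\<lambda>A B. mat n n (\<lambda>(i, j).
                if i \<le> j
                then (\<Oplus>\<^bsub>R\<^esub>k\<in>{i..j}. A $$ (i, k) \<otimes>\<^bsub>R\<^esub> (\<sigma> ^^ (k - i)) (B $$ (k, j)))
                else \<zero>\<^bsub>R\<^esub>)),
      one = mat n n (\<lambda>(i, j). if i = j then \<one>\<^bsub>R\<^esub> else \<zero>\<^bsub>R\<^esub>),
      zero = mat n n (\<lambda>(i, j). \<zero>\<^bsub>R\<^esub>),
      add = (\<lambda>A B. mat n n (\<lambda>(i, j). A $$ (i, j) \<oplus>\<^bsub>R\<^esub> B $$ (i, j)))\<rparr>"

context ring begin

lemma funpow_ring_endo:
  assumes "\<sigma> \<in> ring_hom R R"
  shows "\<sigma> ^^ m \<in> ring_hom R R"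
proof (induction m)
  case 0
  then show ?case by (auto intro!: ring_hom_memI)
next
  case (Suc m)
  then show ?case using ring_hom_trans[OF Suc assms] by (simp add: comp_def)
qed

lemma hom_zero_endo: "h \<in> ring_hom R R \<Longrightarrow> h \<zero> = \<zero>"
  using ring_hom_zero[OF _ ring_axioms ring_axioms] by blast

lemma hom_finsum_endo:
  assumes h: "h \<in> ring_hom R R" and f: "f \<in> A \<rightarrow> carrier R" and "finite A"
  shows "h (finsum R f A) = finsum R (\<lambda>x. h (f x)) A"
  using assms(3) f
proof (induction A)
  case empty
  then show ?case using hom_zero_endo[OF h] by simp
next
  case (insert x A)
  have "(\<lambda>x. h (f x)) \<in> A \<rightarrow> carrier R" "h (f x) \<in> carrier R"
    using insert.prems ring_hom_closed[OF h] by auto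
  then show ?case using insert ring_hom_add[OF h] by (simp add: finsum_insert Pi_iff)
qed

end

lemma skew_triangular_ring_is_ring:
  fixes R :: "('a, 'm) ring_scheme" (structure)
  assumes "ring R" and s: "\<sigma> \<in> ring_hom R R"
  shows "ring (skew_triangular_ring n R \<sigma>)"
proof -
  interpret ring R by fact
  let ?T = "skew_triangular_ring n R \<sigma>"
  let ?p = "\<lambda>m. \<sigma> ^^ m"
  note p = funpow_ring_endo[OF s]
  have pc [simp]: "x \<in> carrier R \<Longrightarrow> ?p m x \<in> carrier R" for m x
    using ring_hom_closed[OF p] .
  have pz [simp]: "?p m \<zero> = \<zero>" for m using hom_zero_endo[OF p] .
  have po [simp]: "?p m \<one> = \<one>" for m using ring_hom_one[OF p] .
  have pm: "x \<in> carrier R \<Longrightarrow> y \<in> carrier R \<Longrightarrow> ?p m (x \<otimes> y) = ?p m x \<otimes> ?p m y" for m x y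
    using ring_hom_mult[OF p] .
  have pa: "x \<in> carrier R \<Longrightarrow> y \<in> carrier R \<Longrightarrow> ?p m (x \<oplus> y) = ?p m x \<oplus> ?p m y" for m x y
    using ring_hom_add[OF p] .
  have ent: "A $$ (i, j) \<in> carrier R" if "A \<in> carrier ?T" "i < n" "j < n" for A i j
    using that by (auto simp: skew_triangular_ring_def)
  have low: "A $$ (i, j) = \<zero>" if "A \<in> carrier ?T" "i < n" "j < i" for A i j
    using that by (auto simp: skew_triangular_ring_def)
  have dims: "dim_row A = n" "dim_col A = n" if "A \<in> carrier ?T" for A
    using that by (auto simp: skew_triangular_ring_def)
  have memI: "mat n n f \<in> carrier ?T"
    if "\<And>i j. i < n \<Longrightarrow> j < n \<Longrightarrow> f (i, j) \<in> carrier R" "\<And>i j. i < n \<Longrightarrow> j < i \<Longrightarrow> f (i, j) = \<zero>" for f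
    using that by (auto simp: skew_triangular_ring_def)
  have eqI: "A = B" if "A \<in> carrier ?T" "B \<in> carrier ?T"
     "\<And>i j. i \<le> j \<Longrightarrow> j < n \<Longrightarrow> A $$ (i, j) = B $$ (i, j)" for A B
  proof (rule eq_matI)
    fix i j assume "i < dim_row B" "j < dim_col B"
    then show "A $$ (i, j) = B $$ (i, j)"
      using that low[OF that(1), of i j] low[OF that(2), of i j] dims[OF that(2)]
      by (cases "i \<le> j") auto
  qed (use dims that in auto)
  have add: "(A \<oplus>\<^bsub>?T\<^esub> B) $$ (i, j) = A $$ (i, j) \<oplus> B $$ (i, j)" if "i < n" "j < n" for A B i j
    using that by (simp add: skew_triangular_ring_def)
  have zero: "\<zero>\<^bsub>?T\<^esub> $$ (i, j) = \<zero>" if "i < n" "j < n" for i j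
    using that by (simp add: skew_triangular_ring_def)
  have one: "\<one>\<^bsub>?T\<^esub> $$ (i, j) = (if i = j then \<one> else \<zero>)" if "i < n" "j < n" for i j
    using that by (simp add: skew_triangular_ring_def)
  have mult: "(A \<otimes>\<^bsub>?T\<^esub> B) $$ (i, j) = (\<Oplus>k\<in>{i..j}. A $$ (i, k) \<otimes> ?p (k - i) (B $$ (k, j)))"
    if "i \<le> j" "j < n" for A B i j
    using that by (simp add: skew_triangular_ring_def)
  have addC: "A \<oplus>\<^bsub>?T\<^esub> B \<in> carrier ?T" if "A \<in> carrier ?T" "B \<in> carrier ?T" for A B
  proof -
    have "A \<oplus>\<^bsub>?T\<^esub> B = mat n n (\<lambda>(i, j). A $$ (i, j) \<oplus> B $$ (i, j))"
      by (simp add: skew_triangular_ring_def)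
    then show ?thesis using that ent low by (auto intro!: memI)
  qed
  have zeroC: "\<zero>\<^bsub>?T\<^esub> \<in> carrier ?T" and oneC: "\<one>\<^bsub>?T\<^esub> \<in> carrier ?T"
    by (auto simp: skew_triangular_ring_def)
  have multC: "A \<otimes>\<^bsub>?T\<^esub> B \<in> carrier ?T" if "A \<in> carrier ?T" "B \<in> carrier ?T" for A B
  proof -
    have "(\<Oplus>k\<in>{i..j}. A $$ (i, k) \<otimes> ?p (k - i) (B $$ (k, j))) \<in> carrier R"
      if "i < n" "j < n" for i j
      using that ent \<open>A \<in> carrier ?T\<close> \<open>B \<in> carrier ?T\<close> by (intro finsum_closed) auto
    moreover have "A \<otimes>\<^bsub>?T\<^esub> B = mat n n (\<lambda>(i, j). if i \<le> j
                then (\<Oplus>k\<in>{i..j}. A $$ (i, k) \<otimes> ?p (k - i) (B $$ (k, j))) else \<zero>)"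
      by (simp add: skew_triangular_ring_def)
    ultimately show ?thesis by (auto intro!: memI)
  qed
  show ?thesis
  proof (intro ringI abelian_groupI monoidI)
    fix A assume A: "A \<in> carrier ?T"
    let ?N = "mat n n (\<lambda>(i, j). \<ominus> A $$ (i, j))"
    have N: "?N \<in> carrier ?T" using ent[OF A] low[OF A] by (intro memI) auto
    moreover have "?N \<oplus>\<^bsub>?T\<^esub> A = \<zero>\<^bsub>?T\<^esub>"
      by (rule eqI) (use A N zeroC addC ent[OF A] in \<open>auto simp: add zero l_neg\<close>)
    ultimately show "\<exists>B\<in>carrier ?T. B \<oplus>\<^bsub>?T\<^esub> A = \<zero>\<^bsub>?T\<^esub>" by blast
  next
    fix A assume A: "A \<in> carrier ?T"
    show "\<one>\<^bsub>?T\<^esub> \<otimes>\<^bsub>?T\<^esub> A = A"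
    proof (rule eqI)
      fix i j assume ij: "i \<le> j" "j < n"
      have "(\<one>\<^bsub>?T\<^esub> \<otimes>\<^bsub>?T\<^esub> A) $$ (i, j) = (\<Oplus>k\<in>{i..j}. if i = k then A $$ (k, j) else \<zero>)"
        unfolding mult[OF ij] using ij ent[OF A] by (intro finsum_cong') (auto simp: one)
      also have "\<dots> = A $$ (i, j)"
        using ij ent[OF A] by (intro finsum_singleton) auto
      finally show "(\<one>\<^bsub>?T\<^esub> \<otimes>\<^bsub>?T\<^esub> A) $$ (i, j) = A $$ (i, j)" .
    qed (use A oneC multC in auto)
    show "A \<otimes>\<^bsub>?T\<^esub> \<one>\<^bsub>?T\<^esub> = A"
    proof (rule eqI)
      fix i j assume ij: "i \<le> j" "j < n"
      have "(A \<otimes>\<^bsub>?T\<^esub> \<one>\<^bsub>?T\<^esub>) $$ (i, j) = (\<Oplus>k\<in>{i..j}. if j = k then A $$ (i, k) else \<zero>)"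
        unfolding mult[OF ij] using ij ent[OF A] by (intro finsum_cong') (auto simp: one)
      also have "\<dots> = A $$ (i, j)"
        using ij ent[OF A] by (intro finsum_singleton) auto
      finally show "(A \<otimes>\<^bsub>?T\<^esub> \<one>\<^bsub>?T\<^esub>) $$ (i, j) = A $$ (i, j)" .
    qed (use A oneC multC in auto)
  next
    fix A B C assume A: "A \<in> carrier ?T" and B: "B \<in> carrier ?T" and C: "C \<in> carrier ?T"
    show "A \<otimes>\<^bsub>?T\<^esub> B \<otimes>\<^bsub>?T\<^esub> C = A \<otimes>\<^bsub>?T\<^esub> (B \<otimes>\<^bsub>?T\<^esub> C)"
    proof (rule eqI)
      fix i j assume ij: "i \<le> j" "j < n"
      let ?f = "\<lambda>k l. A $$ (i, l) \<otimes> (?p (l - i) (B $$ (l, k)) \<otimes> ?p (k - i) (C $$ (k, j)))"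
      note e = ent[OF A] ent[OF B] ent[OF C]
      have fc: "?f k l \<in> carrier R" if "k \<in> {i..j}" "l \<in> {i..j}" for k l
        using that ij e by auto
      have fz: "?f k l = \<zero>" if "k \<in> {i..j}" "l \<in> {i..j}" "k < l" for k l
        using that ij e low[OF B, of l k] by auto
      have 1: "(A \<otimes>\<^bsub>?T\<^esub> B) $$ (i, k) \<otimes> ?p (k - i) (C $$ (k, j)) = (\<Oplus>l\<in>{i..j}. ?f k l)"
        if k: "k \<in> {i..j}" for k
      proof -
        have "(A \<otimes>\<^bsub>?T\<^esub> B) $$ (i, k) \<otimes> ?p (k - i) (C $$ (k, j))
            = (\<Oplus>l\<in>{i..k}. A $$ (i, l) \<otimes> ?p (l - i) (B $$ (l, k)) \<otimes> ?p (k - i) (C $$ (k, j)))"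
          using k ij e by (simp add: mult finsum_ldistr Pi_iff)
        also have "\<dots> = (\<Oplus>l\<in>{i..k}. ?f k l)"
          using k ij e by (intro finsum_cong') (auto simp: m_assoc)
        also have "\<dots> = (\<Oplus>l\<in>{i..j}. ?f k l)"
          using k fc fz by (intro add.finprod_mono_neutral_cong_left) auto
        finally show ?thesis .
      qed
      have 2: "A $$ (i, l) \<otimes> ?p (l - i) ((B \<otimes>\<^bsub>?T\<^esub> C) $$ (l, j)) = (\<Oplus>k\<in>{i..j}. ?f k l)"
        if l: "l \<in> {i..j}" for l
      proof -
        have "?p (l - i) ((B \<otimes>\<^bsub>?T\<^esub> C) $$ (l, j))
            = (\<Oplus>k\<in>{l..j}. ?p (l - i) (B $$ (l, k) \<otimes> ?p (k - l) (C $$ (k, j))))"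
          using l ij e by (simp add: mult) (intro hom_finsum_endo[OF p]; auto)
        also have "\<dots> = (\<Oplus>k\<in>{l..j}. ?p (l - i) (B $$ (l, k)) \<otimes> ?p (k - i) (C $$ (k, j)))"
        proof (rule finsum_cong')
          fix k assume k: "k \<in> {l..j}"
          have "?p (l - i) (?p (k - l) x) = ?p (k - i) x" for x
            using k l funpow_add[of "l - i" "k - l" \<sigma>] by (auto simp: fun_eq_iff)
          then show "?p (l - i) (B $$ (l, k) \<otimes> ?p (k - l) (C $$ (k, j)))
              = ?p (l - i) (B $$ (l, k)) \<otimes> ?p (k - i) (C $$ (k, j))"
            using k l ij e by (simp add: pm)
        qed (use l ij e in auto)
        finally have "A $$ (i, l) \<otimes> ?p (l - i) ((B \<otimes>\<^bsub>?T\<^esub> C) $$ (l, j)) = (\<Oplus>k\<in>{l..j}. ?f k l)"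
          using l ij e by (simp add: finsum_rdistr Pi_iff)
        also have "\<dots> = (\<Oplus>k\<in>{i..j}. ?f k l)"
          using l fc fz by (intro add.finprod_mono_neutral_cong_left) auto
        finally show ?thesis .
      qed
      have "(A \<otimes>\<^bsub>?T\<^esub> B \<otimes>\<^bsub>?T\<^esub> C) $$ (i, j) = (\<Oplus>k\<in>{i..j}. \<Oplus>l\<in>{i..j}. ?f k l)"
        unfolding mult[OF ij] using 1 fc by (intro finsum_cong') (auto intro!: finsum_closed)
      also have "\<dots> = (\<Oplus>l\<in>{i..j}. \<Oplus>k\<in>{i..j}. ?f k l)"
        using fc by (intro finsum_finsum_swap) auto
      also have "\<dots> = (A \<otimes>\<^bsub>?T\<^esub> (B \<otimes>\<^bsub>?T\<^esub> C)) $$ (i, j)"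
        unfolding mult[OF ij, of A] using 2 fc
        by (intro finsum_cong'[symmetric]) (auto intro!: finsum_closed)
      finally show "(A \<otimes>\<^bsub>?T\<^esub> B \<otimes>\<^bsub>?T\<^esub> C) $$ (i, j) = (A \<otimes>\<^bsub>?T\<^esub> (B \<otimes>\<^bsub>?T\<^esub> C)) $$ (i, j)" .
    qed (use A B C multC in auto)
    note e = ent[OF A] ent[OF B] ent[OF C]
    show "(A \<oplus>\<^bsub>?T\<^esub> B) \<otimes>\<^bsub>?T\<^esub> C = A \<otimes>\<^bsub>?T\<^esub> C \<oplus>\<^bsub>?T\<^esub> B \<otimes>\<^bsub>?T\<^esub> C"
    proof (rule eqI)
      fix i j assume ij: "i \<le> j" "j < n"
      have "(A \<otimes>\<^bsub>?T\<^esub> C \<oplus>\<^bsub>?T\<^esub> B \<otimes>\<^bsub>?T\<^esub> C) $$ (i, j) =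
        (\<Oplus>k\<in>{i..j}. A $$ (i, k) \<otimes> ?p (k - i) (C $$ (k, j)) \<oplus> B $$ (i, k) \<otimes> ?p (k - i) (C $$ (k, j)))"
        using ij e by (simp add: add mult Pi_iff)
      also have "\<dots> = ((A \<oplus>\<^bsub>?T\<^esub> B) \<otimes>\<^bsub>?T\<^esub> C) $$ (i, j)"
        unfolding mult[OF ij] using ij e by (intro finsum_cong') (auto simp: add l_distr)
      finally show "((A \<oplus>\<^bsub>?T\<^esub> B) \<otimes>\<^bsub>?T\<^esub> C) $$ (i, j) = (A \<otimes>\<^bsub>?T\<^esub> C \<oplus>\<^bsub>?T\<^esub> B \<otimes>\<^bsub>?T\<^esub> C) $$ (i, j)" by simp
    qed (use A B C multC addC in auto)
    show "C \<otimes>\<^bsub>?T\<^esub> (A \<oplus>\<^bsub>?T\<^esub> B) = C \<otimes>\<^bsub>?T\<^esub> A \<oplus>\<^bsub>?T\<^esub> C \<otimes>\<^bsub>?T\<^esub> B"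
    proof (rule eqI)
      fix i j assume ij: "i \<le> j" "j < n"
      have "(C \<otimes>\<^bsub>?T\<^esub> A \<oplus>\<^bsub>?T\<^esub> C \<otimes>\<^bsub>?T\<^esub> B) $$ (i, j) =
        (\<Oplus>k\<in>{i..j}. C $$ (i, k) \<otimes> ?p (k - i) (A $$ (k, j)) \<oplus> C $$ (i, k) \<otimes> ?p (k - i) (B $$ (k, j)))"
        using ij e by (simp add: add mult Pi_iff)
      also have "\<dots> = (C \<otimes>\<^bsub>?T\<^esub> (A \<oplus>\<^bsub>?T\<^esub> B)) $$ (i, j)"
        unfolding mult[OF ij] using ij e by (intro finsum_cong') (auto simp: add r_distr pa)
      finally show "(C \<otimes>\<^bsub>?T\<^esub> (A \<oplus>\<^bsub>?T\<^esub> B)) $$ (i, j) = (C \<otimes>\<^bsub>?T\<^esub> A \<oplus>\<^bsub>?T\<^esub> C \<otimes>\<^bsub>?T\<^esub> B) $$ (i, j)" by simp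
    qed (use A B C multC addC in auto)
    show "A \<oplus>\<^bsub>?T\<^esub> B \<oplus>\<^bsub>?T\<^esub> C = A \<oplus>\<^bsub>?T\<^esub> (B \<oplus>\<^bsub>?T\<^esub> C)"
      by (rule eqI) (use A B C addC e in \<open>auto simp: add a_assoc\<close>)
  next
    fix A B assume A: "A \<in> carrier ?T" and B: "B \<in> carrier ?T"
    show "A \<oplus>\<^bsub>?T\<^esub> B = B \<oplus>\<^bsub>?T\<^esub> A"
      by (rule eqI) (use A B addC ent[OF A] ent[OF B] in \<open>auto simp: add a_comm\<close>)
  next
    fix A assume A: "A \<in> carrier ?T"
    show "\<zero>\<^bsub>?T\<^esub> \<oplus>\<^bsub>?T\<^esub> A = A"
      by (rule eqI) (use A addC zeroC ent[OF A] in \<open>auto simp: add zero\<close>)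
  qed (use addC multC zeroC oneC in auto)
qed

definition strongly_clean :: "('a, 'm) ring_scheme \<Rightarrow> 'a \<Rightarrow> bool" where
  "strongly_clean S a \<longleftrightarrow>
     (\<exists>e\<in>carrier S. \<exists>u\<in>Units S.
        e \<otimes>\<^bsub>S\<^esub> e = e \<and> a = e \<oplus>\<^bsub>S\<^esub> u \<and> e \<otimes>\<^bsub>S\<^esub> u = u \<otimes>\<^bsub>S\<^esub> e)"

definition strongly_clean_ring :: "('a, 'm) ring_scheme \<Rightarrow> bool" where
  "strongly_clean_ring S \<longleftrightarrow> ring S \<and> (\<forall>a\<in>carrier S. strongly_clean S a)"

definition left_mult :: "('a, 'm) ring_scheme \<Rightarrow> 'a \<Rightarrow> 'a \<Rightarrow> 'a" where
  "left_mult R a r = a \<otimes>\<^bsub>R\<^esub> r"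

definition right_mult :: "('a, 'm) ring_scheme \<Rightarrow> 'a \<Rightarrow> 'a \<Rightarrow> 'a" where
  "right_mult R a r = r \<otimes>\<^bsub>R\<^esub> a"

end

(* If f = f m with m in J(R), then 1 - m is right invertible and so f = 0.  Hence in a strongly
   clean decomposition A = E + U in T_n(R, sigma), the diagonal entry of E is 0 where that of A
   lies in 1 + J(R), and 1 where that of A lies in J(R).  For a matrix A with entries a, b at the
   diagonal positions 0 and p, v at (0, p), and zeros elsewhere, the (0, p) entry of E A = A E
   then reads a x - x sigma^p(b) = -v or = v, where x is the (0, p) entry of E. *)
theory Submission
  imports Defs
begin

context ring begin

section \<open>Right ideals and the existence of maximal ones\<close>

lemma right_ideal_eq_carrier:
  assumes "right_ideal I R" "\<one> \<in> I"
  shows "I = carrier R"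
proof -
  interpret additive_subgroup I R using assms(1) by (simp add: right_ideal_def)
  have "x \<in> I" if "x \<in> carrier R" for x
  proof -
    have "\<one> \<otimes> x \<in> I" using assms that unfolding right_ideal_def by blast
    then show ?thesis using that by simp
  qed
  then show ?thesis using a_subset by blast
qed

text \<open>The chain condition enters in closure under addition: of two members containing the two
  summands, the larger one contains both.\<close>

lemma right_ideal_Union_chain:
  assumes "\<C> \<noteq> {}" "\<And>I. I \<in> \<C> \<Longrightarrow> right_ideal I R"
    and chain: "\<And>I K. I \<in> \<C> \<Longrightarrow> K \<in> \<C> \<Longrightarrow> I \<subseteq> K \<or> K \<subseteq> I"
  shows "right_ideal (\<Union>\<C>) R"
proof -
  have sub: "additive_subgroup I R" if "I \<in> \<C>" for I
    using assms(2)[OF that] by (simp add: right_ideal_def)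
  have "subgroup (\<Union>\<C>) (add_monoid R)"
  proof (rule add.subgroupI)
    show "\<Union>\<C> \<subseteq> carrier R" using additive_subgroup.a_subset[OF sub] by blast
    show "\<Union>\<C> \<noteq> {}" using assms(1) additive_subgroup.zero_closed[OF sub] by blast
  next
    fix x assume "x \<in> \<Union>\<C>"
    then obtain I where I: "I \<in> \<C>" "x \<in> I" by blast
    then have "\<ominus> x \<in> I"
      using additive_subgroup.a_subgroup[OF sub] subgroup.m_inv_closed by (fastforce simp: a_inv_def)
    then show "\<ominus> x \<in> \<Union>\<C>" using I by blast
  next
    fix x y assume "x \<in> \<Union>\<C>" "y \<in> \<Union>\<C>"
    then obtain I K where "I \<in> \<C>" "x \<in> I" "K \<in> \<C>" "y \<in> K" by blast
    then obtain L where L: "L \<in> \<C>" "x \<in> L" "y \<in> L" using chain by blast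
    then have "x \<oplus> y \<in> L" using additive_subgroup.a_closed[OF sub] by blast
    then show "x \<oplus> y \<in> \<Union>\<C>" using L by blast
  qed
  then show ?thesis
    using assms(2) unfolding right_ideal_def additive_subgroup_def by blast
qed

text \<open>Zorn's lemma, applied to the right ideals above \<open>I\<close> that avoid
  \<open>\<one>\<close>. A right ideal is proper iff it avoids \<open>\<one>\<close>, a condition
  that passes to unions of chains, so a maximal element of this family is a maximal right
  ideal.\<close>

lemma ex_maximal_right_ideal:
  assumes I: "right_ideal I R" "\<one> \<notin> I"
  obtains M where "maximal_right_ideal M R" "I \<subseteq> M"
proof -
  let ?P = "{K. right_ideal K R \<and> I \<subseteq> K \<and> \<one> \<notin> K}"
  have "\<exists>M\<in>?P. \<forall>K\<in>?P. M \<subseteq> K \<longrightarrow> K = M"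
  proof (rule subset_Zorn_nonempty)
    show "?P \<noteq> {}" using I by blast
  next
    fix \<C> assume \<C>: "\<C> \<noteq> {}" "subset.chain ?P \<C>"
    then have sub: "\<C> \<subseteq> ?P" and chain: "\<And>K L. K \<in> \<C> \<Longrightarrow> L \<in> \<C> \<Longrightarrow> K \<subseteq> L \<or> L \<subseteq> K"
      by (simp_all add: subset_chain_def)
    have "right_ideal (\<Union>\<C>) R"
      by (rule right_ideal_Union_chain[OF \<C>(1) _ chain]) (use sub in blast)
    moreover have "I \<subseteq> \<Union>\<C>" "\<one> \<notin> \<Union>\<C>" using sub \<C>(1) by blast+
    ultimately show "\<Union>\<C> \<in> ?P" by simp
  qed
  then obtain M where "M \<in> ?P" and max_P: "\<And>K. K \<in> ?P \<Longrightarrow> M \<subseteq> K \<Longrightarrow> K = M"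
    by (elim bexE) simp
  then have M: "right_ideal M R" "I \<subseteq> M" "\<one> \<notin> M" by simp_all
  have max: "K = M" if "right_ideal K R" "M \<subseteq> K" "\<one> \<notin> K" for K
    using max_P that M(2) by auto
  have "K = M \<or> K = carrier R" if "right_ideal K R" "M \<subseteq> K" for K
    using max[OF that] right_ideal_eq_carrier[OF that(1)] by blast
  then have "maximal_right_ideal M R"
    using M one_closed unfolding maximal_right_ideal_def by blast
  then show thesis using M(2) that by blast
qed

lemma right_ideal_principal:
  assumes "y \<in> carrier R"
  shows "right_ideal ((\<otimes>) y ` carrier R) R"
proof -
  have "subgroup ((\<otimes>) y ` carrier R) (add_monoid R)"
  proof (rule add.subgroupI)
    fix x assume "x \<in> (\<otimes>) y ` carrier R"
    then obtain r where "r \<in> carrier R" "x = y \<otimes> r" by blast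
    then show "\<ominus> x \<in> (\<otimes>) y ` carrier R"
      using assms by (intro image_eqI[of _ _ "\<ominus> r"]) (auto simp: r_minus)
  next
    fix x z assume "x \<in> (\<otimes>) y ` carrier R" "z \<in> (\<otimes>) y ` carrier R"
    then obtain r s where "r \<in> carrier R" "x = y \<otimes> r" "s \<in> carrier R" "z = y \<otimes> s" by blast
    then show "x \<oplus> z \<in> (\<otimes>) y ` carrier R"
      using assms by (intro image_eqI[of _ _ "r \<oplus> s"]) (auto simp: r_distr)
  qed (use assms in auto)
  moreover have "y \<otimes> s \<otimes> r \<in> (\<otimes>) y ` carrier R" if "s \<in> carrier R" "r \<in> carrier R" for s r
    using that assms by (intro image_eqI[of _ _ "s \<otimes> r"]) (auto simp: m_assoc)
  ultimately show ?thesis by (auto simp: right_ideal_def additive_subgroup_def)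
qed

section \<open>The Jacobson radical and right invertibility\<close>

lemma jacobson_radical_closed: "m \<in> jacobson_radical R \<Longrightarrow> m \<in> carrier R"
  by (simp add: jacobson_radical_def)

lemma jacobson_radical_mult_right:
  "m \<in> jacobson_radical R \<Longrightarrow> r \<in> carrier R \<Longrightarrow> m \<otimes> r \<in> jacobson_radical R"
  by (auto simp: jacobson_radical_def maximal_right_ideal_def right_ideal_def)

text \<open>If the right ideal (1 - m)R were proper, some maximal right ideal M would contain it. As
  m lies in every such M, so would 1 = (1 - m) + m.\<close>

lemma one_minus_jacobson_right_invertible:
  assumes m: "m \<in> jacobson_radical R"
  obtains r where "r \<in> carrier R" "(\<one> \<ominus> m) \<otimes> r = \<one>"
proof -
  have mc: "m \<in> carrier R" using m by (rule jacobson_radical_closed)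
  let ?I = "(\<otimes>) (\<one> \<ominus> m) ` carrier R"
  have "\<one> \<in> ?I"
  proof (rule ccontr)
    assume "\<one> \<notin> ?I"
    moreover have "right_ideal ?I R" using mc by (intro right_ideal_principal) simp
    ultimately obtain M where M: "maximal_right_ideal M R" "?I \<subseteq> M"
      using ex_maximal_right_ideal by blast
    then interpret additive_subgroup M R
      by (simp add: maximal_right_ideal_def right_ideal_def)
    have "\<one> \<ominus> m \<in> ?I" using mc by (intro image_eqI[of _ _ \<one>]) auto
    then have "(\<one> \<ominus> m) \<oplus> m \<in> M"
      using M m by (intro a_closed) (auto simp: jacobson_radical_def)
    then have "\<one> \<in> M" using mc by (simp add: minus_eq a_assoc l_neg)
    then show False
      using M right_ideal_eq_carrier by (auto simp: maximal_right_ideal_def)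
  qed
  then show thesis using that by (metis imageE)
qed

text \<open>The equation reads f (1 - m) = 0. As 1 - m stands on the right of f, multiplying by its
  right inverse from the right isolates f.\<close>

lemma eq_zero_if_eq_mult_jacobson:
  assumes f: "f \<in> carrier R" and m: "m \<in> jacobson_radical R" and eq: "f = f \<otimes> m"
  shows "f = \<zero>"
proof -
  have mc: "m \<in> carrier R" using m by (rule jacobson_radical_closed)
  obtain r where r: "r \<in> carrier R" "(\<one> \<ominus> m) \<otimes> r = \<one>"
    using one_minus_jacobson_right_invertible[OF m] .
  have "f \<otimes> (\<one> \<ominus> m) = f \<ominus> f \<otimes> m"
    using f mc by (simp add: minus_eq r_distr r_minus)
  also have "\<dots> = \<zero>" using eq f by (simp add: minus_eq r_neg)
  finally have "f \<otimes> ((\<one> \<ominus> m) \<otimes> r) = \<zero>"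
    using f mc r(1) by (simp flip: m_assoc)
  then show ?thesis using r f by simp
qed

text \<open>Multiplying e + u = 1 + m by e from the left gives e + e u = e + e m, hence e u = e m.
  Then multiplying by w from the right gives e = e (m w), where m w stays in J(R), an intersection
  of right ideals.\<close>

lemma idem_eq_zero_if_clean_one_plus_jacobson:
  assumes c: "e \<in> carrier R" "u \<in> carrier R" "w \<in> carrier R"
    and e: "e \<otimes> e = e" and w: "u \<otimes> w = \<one>" and a: "e \<oplus> u \<in> \<one> <+ jacobson_radical R"
  shows "e = \<zero>"
proof -
  obtain m where m: "m \<in> jacobson_radical R" "e \<oplus> u = \<one> \<oplus> m"
    using a by (auto simp: a_l_coset_def l_coset_def)
  note mc = jacobson_radical_closed[OF m(1)]
  have "e \<oplus> e \<otimes> u = e \<otimes> (e \<oplus> u)" using c e by (simp add: r_distr)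
  also have "\<dots> = e \<oplus> e \<otimes> m" using c mc by (simp add: m(2) r_distr)
  finally have "e \<otimes> u = e \<otimes> m" using c mc by simp
  then have "e \<otimes> (u \<otimes> w) = e \<otimes> (m \<otimes> w)"
    using c mc by (simp flip: m_assoc)
  then have "e = e \<otimes> (m \<otimes> w)" using c w by simp
  then show ?thesis
    using eq_zero_if_eq_mult_jacobson c jacobson_radical_mult_right m(1) by blast
qed

text \<open>Here the complement f = 1 - e takes the place of e. It annihilates e from the left, so f
  u = f (e + u), and multiplying by w from the right gives f = f ((e + u) w) with (e + u) w in
  J(R).\<close>

lemma idem_eq_one_if_clean_jacobson:
  assumes c: "e \<in> carrier R" "u \<in> carrier R" "w \<in> carrier R"
    and e: "e \<otimes> e = e" and w: "u \<otimes> w = \<one>" and m: "e \<oplus> u \<in> jacobson_radical R"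
  shows "e = \<one>"
proof -
  let ?f = "\<one> \<ominus> e"
  have f: "?f \<in> carrier R" using c by simp
  have "?f \<otimes> e = \<zero>" using c e by (simp add: minus_eq l_distr l_minus r_neg)
  then have "?f \<otimes> (e \<oplus> u) = ?f \<otimes> u" using c f by (simp add: r_distr)
  then have "?f \<otimes> (u \<otimes> w) = ?f \<otimes> ((e \<oplus> u) \<otimes> w)"
    using c f by (simp flip: m_assoc)
  then have "?f = ?f \<otimes> ((e \<oplus> u) \<otimes> w)" using f w by simp
  then have "?f = \<zero>"
    using eq_zero_if_eq_mult_jacobson[OF f] c jacobson_radical_mult_right m by blast
  moreover have "?f \<oplus> e = \<one>" using c by (simp add: minus_eq a_assoc l_neg)
  ultimately show ?thesis using c by simp
qed

section \<open>The corner entry of a strongly clean decomposition\<close>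

lemma finsum_atMost_endpoints:
  fixes p :: nat
  assumes "0 < p" "\<And>k. k \<le> p \<Longrightarrow> f k \<in> carrier R" "\<And>k. 0 < k \<Longrightarrow> k < p \<Longrightarrow> f k = \<zero>"
  shows "(\<Oplus>k\<in>{0..p}. f k) = f 0 \<oplus> f p"
proof -
  have "(\<Oplus>k\<in>{0..p}. f k) = (\<Oplus>k\<in>{0, p}. f k)"
  proof (rule add.finprod_mono_neutral_cong_right)
    show "f k = \<zero>" if "k \<in> {0..p} - {0, p}" for k using assms(3)[of k] that by simp
    show "f \<in> {0..p} \<rightarrow> carrier R" using assms(2) by simp
  qed auto
  also have "\<dots> = f 0 \<oplus> f p"
    using finsum_insert[of "{p}" 0 f] assms(1) assms(2)[of 0] assms(2)[of p] by simp
  finally show ?thesis .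
qed

text \<open>For a decomposition \<open>A = E + U\<close> with \<open>W\<close> a right inverse of
  \<open>U\<close>, the elements e, f, x are entries of \<open>E\<close>, while u, u' and w, w' are
  diagonal entries of \<open>U\<close> and \<open>W\<close>. The last equation compares the entries
  of \<open>E A\<close> and \<open>A E\<close> at (0, p). The elements a and b stay arbitrary
  because the element of 1 + J(R) is needed at either diagonal position.\<close>

lemma strongly_clean_skew_corner:
  assumes s: "\<sigma> \<in> ring_hom R R"
    and T: "strongly_clean_ring (skew_triangular_ring n R \<sigma>)"
    and p: "0 < p" "p < n"
    and c: "a \<in> carrier R" "b \<in> carrier R" "v \<in> carrier R"
  obtains e f x u w u' w' where
    "{e, f, x, u, w, u', w'} \<subseteq> carrier R"
    "e \<otimes> e = e" "u \<otimes> w = \<one>" "a = e \<oplus> u"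
    "f \<otimes> f = f" "u' \<otimes> w' = \<one>" "b = f \<oplus> u'"
    "e \<otimes> v \<oplus> x \<otimes> (\<sigma> ^^ p) b = a \<otimes> x \<oplus> v \<otimes> (\<sigma> ^^ p) f"
proof -
  let ?T = "skew_triangular_ring n R \<sigma>"
  interpret T: ring ?T using T by (simp add: strongly_clean_ring_def)
  note h = funpow_ring_endo[OF s]
  have hc: "x \<in> carrier R \<Longrightarrow> (\<sigma> ^^ k) x \<in> carrier R" for k x using ring_hom_closed[OF h] .
  have hz: "(\<sigma> ^^ k) \<zero> = \<zero>" for k using hom_zero_endo[OF h] .
  have ent: "A $$ (i, j) \<in> carrier R" if "A \<in> carrier ?T" "i < n" "j < n" for A i j
    using that by (auto simp: skew_triangular_ring_def)
  have add: "(A \<oplus>\<^bsub>?T\<^esub> B) $$ (i, j) = A $$ (i, j) \<oplus> B $$ (i, j)" if "i < n" "j < n" for A B i j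
    using that by (simp add: skew_triangular_ring_def)
  have mult: "(A \<otimes>\<^bsub>?T\<^esub> B) $$ (i, j) = (\<Oplus>k\<in>{i..j}. A $$ (i, k) \<otimes> (\<sigma> ^^ (k - i)) (B $$ (k, j)))"
    if "i \<le> j" "j < n" for A B i j
    using that by (simp add: skew_triangular_ring_def)
  \<comment> \<open>The sum has the single term k = i, with exponent 0, so no power of
    \<open>\<sigma>\<close> occurs and taking a diagonal entry is multiplicative.\<close>
  have diag: "(A \<otimes>\<^bsub>?T\<^esub> B) $$ (i, i) = A $$ (i, i) \<otimes> B $$ (i, i)"
    if "A \<in> carrier ?T" "B \<in> carrier ?T" "i < n" for A B i
    using that ent by (simp add: mult)
  have one: "\<one>\<^bsub>?T\<^esub> $$ (i, i) = \<one>" if "i < n" for i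
    using that by (simp add: skew_triangular_ring_def)
  define A where "A = mat n n (\<lambda>(i, j). if (i, j) = (0, 0) then a else if (i, j) = (p, p) then b
      else if (i, j) = (0, p) then v else \<zero>)"
  have A: "A \<in> carrier ?T"
    using c p by (auto simp: A_def skew_triangular_ring_def)
  have A_entries: "A $$ (0, 0) = a" "A $$ (p, p) = b" "A $$ (0, p) = v"
    using p by (auto simp: A_def)
  \<comment> \<open>These zeros remove the terms 0 < k < p from the sums for \<open>A E\<close> (row
    0) and \<open>E A\<close> (column p). In \<open>E A\<close> the zero stands under a power of
    \<open>\<sigma>\<close>, which is what \<open>hz\<close> is for.\<close>
  have A_zero: "A $$ (0, k) = \<zero>" "A $$ (k, p) = \<zero>" if "0 < k" "k < p" for k
    using p that by (auto simp: A_def)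
  obtain E U where E: "E \<in> carrier ?T" "E \<otimes>\<^bsub>?T\<^esub> E = E" and U: "U \<in> Units ?T"
    and AEU: "A = E \<oplus>\<^bsub>?T\<^esub> U" and EU: "E \<otimes>\<^bsub>?T\<^esub> U = U \<otimes>\<^bsub>?T\<^esub> E"
    using T A by (auto simp: strongly_clean_ring_def strongly_clean_def)
  obtain W where W: "W \<in> carrier ?T" "U \<otimes>\<^bsub>?T\<^esub> W = \<one>\<^bsub>?T\<^esub>"
    using U by (auto simp: Units_def)
  have Uc: "U \<in> carrier ?T" using U by (rule T.Units_closed)
  \<comment> \<open>\<open>E\<close> commutes with itself and with \<open>U\<close>, hence with
    their sum.\<close>
  have comm: "E \<otimes>\<^bsub>?T\<^esub> A = A \<otimes>\<^bsub>?T\<^esub> E"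
    using E Uc EU by (simp add: AEU T.l_distr T.r_distr)
  have n0: "0 < n" using p by simp
  note e = ent[OF E(1)] ent[OF A]
  have EA: "(E \<otimes>\<^bsub>?T\<^esub> A) $$ (0, p) = E $$ (0, 0) \<otimes> v \<oplus> E $$ (0, p) \<otimes> (\<sigma> ^^ p) b"
    using p e A_zero
    by (subst mult) (auto simp: finsum_atMost_endpoints A_entries hc hz)
  have AE: "(A \<otimes>\<^bsub>?T\<^esub> E) $$ (0, p) = a \<otimes> E $$ (0, p) \<oplus> v \<otimes> (\<sigma> ^^ p) (E $$ (p, p))"
    using p e A_zero
    by (subst mult) (auto simp: finsum_atMost_endpoints A_entries hc hz)
  show thesis
  proof (rule that)
    show "{E $$ (0, 0), E $$ (p, p), E $$ (0, p), U $$ (0, 0), W $$ (0, 0), U $$ (p, p), W $$ (p, p)}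
        \<subseteq> carrier R"
      using p n0 e ent[OF Uc] ent[OF W(1)] by simp
    show "E $$ (0, 0) \<otimes> E $$ (0, 0) = E $$ (0, 0)" "E $$ (p, p) \<otimes> E $$ (p, p) = E $$ (p, p)"
      using diag[OF E(1) E(1)] E(2) p n0 by auto
    show "U $$ (0, 0) \<otimes> W $$ (0, 0) = \<one>" "U $$ (p, p) \<otimes> W $$ (p, p) = \<one>"
      using diag[OF Uc W(1), symmetric] by (simp_all add: W(2) one p n0)
    show "a = E $$ (0, 0) \<oplus> U $$ (0, 0)" "b = E $$ (p, p) \<oplus> U $$ (p, p)"
      using add[OF n0 n0, of E U] add[OF p(2) p(2), of E U] AEU A_entries by auto
    show "E $$ (0, 0) \<otimes> v \<oplus> E $$ (0, p) \<otimes> (\<sigma> ^^ p) b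
        = a \<otimes> E $$ (0, p) \<oplus> v \<otimes> (\<sigma> ^^ p) (E $$ (p, p))"
      using EA AE comm by simp
  qed
qed

section \<open>Surjectivity of differences of left and right multiplications\<close>

lemma one_plus_jacobson_closed: "a \<in> \<one> <+ jacobson_radical R \<Longrightarrow> a \<in> carrier R"
  using jacobson_radical_closed by (auto simp: a_l_coset_def l_coset_def)

lemma surj_mult_diff_one_plus_jacobson:
  assumes s: "\<sigma> \<in> ring_hom R R"
    and T: "strongly_clean_ring (skew_triangular_ring n R \<sigma>)"
    and p: "0 < p" "p < n"
    and a: "a \<in> \<one> <+ jacobson_radical R" and b: "b \<in> jacobson_radical R"
  shows "(\<lambda>r. a \<otimes> r \<ominus> r \<otimes> (\<sigma> ^^ p) b) ` carrier R = carrier R"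
proof
  note ac = one_plus_jacobson_closed[OF a] and bc = jacobson_radical_closed[OF b]
  note h = funpow_ring_endo[OF s, of p]
  have sb: "(\<sigma> ^^ p) b \<in> carrier R" using ring_hom_closed[OF h bc] .
  show "(\<lambda>r. a \<otimes> r \<ominus> r \<otimes> (\<sigma> ^^ p) b) ` carrier R \<subseteq> carrier R"
    using ac sb by auto
  show "carrier R \<subseteq> (\<lambda>r. a \<otimes> r \<ominus> r \<otimes> (\<sigma> ^^ p) b) ` carrier R"
  proof
    fix v assume v: "v \<in> carrier R"
    \<comment> \<open>With e = 0 and f = 1 the corner equation makes a x - x
      \<open>\<sigma>\<close>^p(b) the negative of the corner entry. The entry is therefore taken to
      be -v, so that x is a preimage of v.\<close>
    have mv: "\<ominus> v \<in> carrier R" using v by simp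
    obtain e f x u w u' w' where E:
      "{e, f, x, u, w, u', w'} \<subseteq> carrier R"
      "e \<otimes> e = e" "u \<otimes> w = \<one>" "a = e \<oplus> u"
      "f \<otimes> f = f" "u' \<otimes> w' = \<one>" "b = f \<oplus> u'"
      "e \<otimes> \<ominus> v \<oplus> x \<otimes> (\<sigma> ^^ p) b = a \<otimes> x \<oplus> \<ominus> v \<otimes> (\<sigma> ^^ p) f"
      using strongly_clean_skew_corner[OF s T p ac bc mv] .
    have "e = \<zero>"
      by (rule idem_eq_zero_if_clean_one_plus_jacobson[of e u w]) (use E a in auto)
    moreover have "f = \<one>"
      by (rule idem_eq_one_if_clean_jacobson[of f u' w']) (use E b in auto)
    ultimately have "x \<otimes> (\<sigma> ^^ p) b = a \<otimes> x \<oplus> \<ominus> v"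
      using E(1,8) v sb ring_hom_one[OF h] by simp
    \<comment> \<open>Used with y = v and z = a x, after which z - y is replaced by x
      \<open>\<sigma>\<close>^p(b).\<close>
    moreover have "y = z \<ominus> (z \<oplus> \<ominus> y)" if "y \<in> carrier R" "z \<in> carrier R" for y z
      using that by (simp add: minus_eq minus_add r_neg flip: a_assoc)
    ultimately have "v = a \<otimes> x \<ominus> x \<otimes> (\<sigma> ^^ p) b"
      using E(1) v ac by simp
    then show "v \<in> (\<lambda>r. a \<otimes> r \<ominus> r \<otimes> (\<sigma> ^^ p) b) ` carrier R"
      using E(1) by blast
  qed
qed

text \<open>The diagonal positions are exchanged: b is at (0, 0) and a at (p, p), so e = 1 and f =
  0. The corner equation becomes v + x \<open>\<sigma>\<close>^p(a) = b x, so the corner entry is v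
  itself, without a sign.\<close>

lemma surj_mult_diff_jacobson:
  assumes s: "\<sigma> \<in> ring_hom R R"
    and T: "strongly_clean_ring (skew_triangular_ring n R \<sigma>)"
    and p: "0 < p" "p < n"
    and a: "a \<in> \<one> <+ jacobson_radical R" and b: "b \<in> jacobson_radical R"
  shows "(\<lambda>r. b \<otimes> r \<ominus> r \<otimes> (\<sigma> ^^ p) a) ` carrier R = carrier R"
proof
  note ac = one_plus_jacobson_closed[OF a] and bc = jacobson_radical_closed[OF b]
  note h = funpow_ring_endo[OF s, of p]
  have sa: "(\<sigma> ^^ p) a \<in> carrier R" using ring_hom_closed[OF h ac] .
  show "(\<lambda>r. b \<otimes> r \<ominus> r \<otimes> (\<sigma> ^^ p) a) ` carrier R \<subseteq> carrier R"
    using bc sa by auto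
  show "carrier R \<subseteq> (\<lambda>r. b \<otimes> r \<ominus> r \<otimes> (\<sigma> ^^ p) a) ` carrier R"
  proof
    fix v assume v: "v \<in> carrier R"
    obtain e f x u w u' w' where E:
      "{e, f, x, u, w, u', w'} \<subseteq> carrier R"
      "e \<otimes> e = e" "u \<otimes> w = \<one>" "b = e \<oplus> u"
      "f \<otimes> f = f" "u' \<otimes> w' = \<one>" "a = f \<oplus> u'"
      "e \<otimes> v \<oplus> x \<otimes> (\<sigma> ^^ p) a = b \<otimes> x \<oplus> v \<otimes> (\<sigma> ^^ p) f"
      using strongly_clean_skew_corner[OF s T p bc ac v] .
    have "e = \<one>"
      by (rule idem_eq_one_if_clean_jacobson[of e u w]) (use E b in auto)
    moreover have "f = \<zero>"
      by (rule idem_eq_zero_if_clean_one_plus_jacobson[of f u' w']) (use E a in auto)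
    ultimately have "b \<otimes> x = v \<oplus> x \<otimes> (\<sigma> ^^ p) a"
      using E(1,8) v bc hom_zero_endo[OF h] by simp
    then have "v = b \<otimes> x \<ominus> x \<otimes> (\<sigma> ^^ p) a"
      using E(1) v sa by (simp add: minus_eq a_assoc r_neg)
    then show "v \<in> (\<lambda>r. b \<otimes> r \<ominus> r \<otimes> (\<sigma> ^^ p) a) ` carrier R"
      using E(1) by blast
  qed
qed

end

theorem theorem4p1:
  fixes R :: "('a, 'm) ring_scheme" (structure) and \<sigma> :: "'a \<Rightarrow> 'a"
  assumes "local_ring R"
    and "\<sigma> \<in> ring_hom R R"
    and "strongly_clean_ring (skew_triangular_ring 3 R \<sigma>)"
  shows "\<forall>a \<in> \<one> <+ jacobson_radical R. \<forall>b \<in> jacobson_radical R.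
      (\<lambda>r. left_mult R a r \<ominus> right_mult R (\<sigma> b) r) ` carrier R = carrier R \<and>
      (\<lambda>r. left_mult R a r \<ominus> right_mult R ((\<sigma> \<circ> \<sigma>) b) r) ` carrier R = carrier R \<and>
      (\<lambda>r. left_mult R b r \<ominus> right_mult R (\<sigma> a) r) ` carrier R = carrier R"
proof -
  interpret ring R using assms(1) by (simp add: local_ring_def)
  note 1 = surj_mult_diff_one_plus_jacobson[OF assms(2,3)]
  note 2 = surj_mult_diff_jacobson[OF assms(2,3)]
  \<comment> \<open>The exponent of \<open>\<sigma>\<close> is the column p of the corner entry.
    Columns 1 and 2 of a 3 x 3 matrix give \<open>\<sigma>\<close> and
    \<open>\<sigma> \<circ> \<sigma>\<close>.\<close>
  show ?thesis
    using 1[of 1] 1[of 2] 2[of 1]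
    by (simp add: left_mult_def right_mult_def numeral_2_eq_2)
qed

end
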